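(* Let $A=(a_{ij})$ be a generic $n\times n$ matrix and $\mathrm{Per}(A)=\sum_{\sigma\in\mathfrak S_n}\prod_{i=1}^n a_{i,\sigma(i)}\in R$ its permanent. Then the apolar ideal $\mathrm{Ann}(\mathrm{Per}(A))\subset S$ equals the ideal $(\mathcal M_D+\mathcal U_D)$ of $S$ generated by $\mathcal M_D+\mathcal U_D$; in particular it is generated in degree two.
   Context: Let $\mathsf k$ be a field of characteristic zero or of characteristic $p>2$. A generic $n\times n$ matrix $A=(a_{ij})$ is one whose entries are $n^2$ distinct variables. Put $R=\mathsf k[a_{ij}]$ and $S=\mathsf k[d_{ij}]$ ($1\le i,j\le n$), polynomial rings with the standard grading, and $D=(d_{ij})$. $S$ acts on $R$ by contraction: $\prod d_{ij}^{\alpha_{ij}}\circ\prod a_{ij}^{\beta_{ij}}=\prod a_{ij}^{\beta_{ij}-\alpha_{ij}}$ if $\alpha_{ij}\le\beta_{ij}$ for all $i,j$, and $0$ otherwise, extended $\mathsf k$-bilinearly. For $F\in R$ homogeneous, $\mathrm{Ann}(F)=\{\Phi\in S:\Phi\circ F=0\}$ is the apolar ideal of $F$. $\mathfrak S_n$ is the symmetric group. $\mathcal M_D\subset S_2$ is the $\mathsf k$-span of all $2\times2$ minors $d_{ij}d_{kl}-d_{il}d_{kj}$ ($i\ne k$, $j\neq l$) of $D$. A monomial in $S$ is acceptable if it is square free and has no two variables from the same row or column of $D$, and unacceptable otherwise; $\mathcal U_D\subset S_2$ is the $\mathsf k$-span of the unacceptable monomials of degree 2. *)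

theory Defs
  imports
    "HOL-Analysis.Finite_Cartesian_Product"
    "HOL-Combinatorics.Permutations"
    "HOL-Library.Poly_Mapping"
    "HOL-Library.Set_Algebras"
begin

text \<open>
  A variable is a pair (row, column), a monomial is an exponent function on the
  variables, and a polynomial maps monomials to coefficients.  Since the index type
  \<open>'n\<close> will be finite, there are \<open>n\<^sup>2\<close> variables with \<open>n = CARD('n)\<close>.  The rings
  \<open>R = k[a_ij]\<close> and \<open>S = k[d_ij]\<close> differ only in the names of their variables;
  both are represented by the type \<open>('n, 'k) matpoly\<close>.
\<close>

type_synonym 'n monomial = "('n \<times> 'n) \<Rightarrow>\<^sub>0 nat"

type_synonym ('n, 'k) matpoly = "'n monomial \<Rightarrow>\<^sub>0 'k"

definition monom_poly :: "'n monomial \<Rightarrow> ('n, 'k::zero_neq_one) matpoly" where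
  "monom_poly m = Poly_Mapping.single m 1"

definition generic_matrix :: "('n::finite, 'k::field) matpoly ^ 'n ^ 'n" where
  "generic_matrix = (\<chi> i j. monom_poly (Poly_Mapping.single (i, j) 1))"

definition permanent :: "'a::comm_ring_1 ^ 'n ^ 'n::finite \<Rightarrow> 'a" where
  "permanent A = (\<Sum>\<sigma> | \<sigma> permutes UNIV. \<Prod>i\<in>UNIV. A $ i $ \<sigma> i)"

definition smult :: "'k::field \<Rightarrow> ('n, 'k) matpoly \<Rightarrow> ('n, 'k) matpoly" where
  "smult c p = Poly_Mapping.single 0 c * p"

lemma vector_space_smult: "vector_space (smult :: 'k::field \<Rightarrow> ('n, 'k) matpoly \<Rightarrow> _)"
  by standard
    (simp_all add: smult_def distrib_left distrib_right single_add
      mult.assoc[symmetric] mult_single)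

lemma module_times: "module ((*) :: ('n, 'k::field) matpoly \<Rightarrow> _)"
  by standard (simp_all add: algebra_simps)

text \<open>
  Both spans below are the span of the library locale \<^locale>\<open>module\<close>, once with the scalars
  \<open>'k\<close> and once with the polynomial ring acting on itself, where it is the generated ideal.
\<close>

definition linear_span :: "('n, 'k::field) matpoly set \<Rightarrow> ('n, 'k) matpoly set" where
  "linear_span = module.span smult"

definition ideal_span :: "('n, 'k::field) matpoly set \<Rightarrow> ('n, 'k) matpoly set" where
  "ideal_span = module.span (*)"

definition monom_degree :: "'n::finite monomial \<Rightarrow> nat" where
  "monom_degree m = (\<Sum>v\<in>UNIV. Poly_Mapping.lookup m v)"

definition homogeneous_part :: "nat \<Rightarrow> ('n::finite, 'k::field) matpoly set" where
  "homogeneous_part d = {p. \<forall>m\<in>Poly_Mapping.keys p. monom_degree m = d}"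

definition generated_in_degree :: "nat \<Rightarrow> ('n::finite, 'k::field) matpoly set \<Rightarrow> bool" where
  "generated_in_degree d I \<longleftrightarrow> (\<exists>G \<subseteq> homogeneous_part d. I = ideal_span G)"

definition contract_monom :: "'n monomial \<Rightarrow> 'n monomial \<Rightarrow> ('n, 'k::field) matpoly" where
  "contract_monom \<alpha> \<beta> =
    (if \<forall>v. Poly_Mapping.lookup \<alpha> v \<le> Poly_Mapping.lookup \<beta> v then monom_poly (\<beta> - \<alpha>) else 0)"

definition contract :: "('n, 'k::field) matpoly \<Rightarrow> ('n, 'k) matpoly \<Rightarrow> ('n, 'k) matpoly"
    (infixr \<open>\<circ>\<^sub>c\<close> 70) where
  "\<Phi> \<circ>\<^sub>c F =
    (\<Sum>\<alpha>\<in>Poly_Mapping.keys \<Phi>. \<Sum>\<beta>\<in>Poly_Mapping.keys F.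
       smult (Poly_Mapping.lookup \<Phi> \<alpha> * Poly_Mapping.lookup F \<beta>) (contract_monom \<alpha> \<beta>))"

lemma contract_monom_poly:
  "(monom_poly \<alpha> :: ('n, 'k::field) matpoly) \<circ>\<^sub>c monom_poly \<beta> = contract_monom \<alpha> \<beta>"
  by (simp add: contract_def monom_poly_def smult_def)

definition apolar_ideal :: "('n, 'k::field) matpoly \<Rightarrow> ('n, 'k) matpoly set" where
  "apolar_ideal F = {\<Phi>. \<Phi> \<circ>\<^sub>c F = 0}"

definition minor_space ::
    "('n, 'k) matpoly ^ 'n ^ 'n \<Rightarrow> ('n::finite, 'k::field) matpoly set" where
  "minor_space D =
    linear_span {D $ i $ j * D $ k $ l - D $ i $ l * D $ k $ j | i j k l. i \<noteq> k \<and> j \<noteq> l}"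

definition acceptable :: "'n monomial \<Rightarrow> bool" where
  "acceptable m \<longleftrightarrow>
    (\<forall>v. Poly_Mapping.lookup m v \<le> 1) \<and>
    (\<forall>v\<in>Poly_Mapping.keys m. \<forall>w\<in>Poly_Mapping.keys m.
       v \<noteq> w \<longrightarrow> fst v \<noteq> fst w \<and> snd v \<noteq> snd w)"

definition unacceptable_space :: "('n::finite, 'k::field) matpoly set" where
  "unacceptable_space =
    linear_span {monom_poly m | m. \<not> acceptable m \<and> monom_degree m = 2}"

end

theory Submission
  imports Defs
begin

text \<open>
  A monomial occurs in the permanent exactly when all of its row and column sums are \<open>1\<close>.  Hence
  \<open>\<Phi> \<circ>\<^sub>c Per = 0\<close> is a condition on the sums of the coefficients of \<open>\<Phi>\<close> over the classes of
  monomials with equal row and column sums.  Modulo the \<open>2 \<times> 2\<close> minors each class collapses to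
  one monomial.  A class of unacceptable monomials lies in the ideal generated by the quadratic
  ones; for a class of acceptable monomials, a complementary monomial \<open>\<gamma>\<close> completes exactly its
  members to permutation monomials, so the coefficient of \<open>\<gamma>\<close> in \<open>\<Phi> \<circ>\<^sub>c Per\<close> is the
  coefficient sum of the class, which therefore vanishes.
\<close>

section \<open>Row and column sums of monomials\<close>

definition row_sum :: "'n::finite monomial \<Rightarrow> 'n \<Rightarrow> nat" where
  "row_sum m i = (\<Sum>j\<in>UNIV. Poly_Mapping.lookup m (i, j))"

definition col_sum :: "'n::finite monomial \<Rightarrow> 'n \<Rightarrow> nat" where
  "col_sum m j = (\<Sum>i\<in>UNIV. Poly_Mapping.lookup m (i, j))"

definition var_monom :: "'n \<Rightarrow> 'n \<Rightarrow> 'n monomial" where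
  "var_monom i j = Poly_Mapping.single (i, j) 1"

lemma lookup_var_monom [simp]:
  "Poly_Mapping.lookup (var_monom i j) v = (if v = (i, j) then 1 else 0)"
  by (auto simp: var_monom_def lookup_single when_def)

text \<open>The polynomial ring as a module over itself and, next, as a vector space; the rewrites
  let the generic span lemmas speak of \<open>ideal_span\<close> and \<open>linear_span\<close>
  directly.\<close>

interpretation ideal: module "(*) :: ('n, 'k::field) matpoly \<Rightarrow> _"
  rewrites "module.span (*) = (ideal_span :: ('n, 'k) matpoly set \<Rightarrow> _)"
  by (rule module_times) (simp add: ideal_span_def)

interpretation linear: vector_space "smult :: 'k::field \<Rightarrow> ('n, 'k) matpoly \<Rightarrow> _"
  rewrites "module.span smult = (linear_span :: ('n, 'k) matpoly set \<Rightarrow> _)"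
  by (rule vector_space_smult) (simp add: linear_span_def)

lemma row_sum_zero [simp]: "row_sum 0 i = 0"
  and col_sum_zero [simp]: "col_sum 0 j = 0"
  by (simp_all add: row_sum_def col_sum_def)

lemma row_sum_add [simp]: "row_sum (m + m') i = row_sum m i + row_sum m' i"
  and col_sum_add [simp]: "col_sum (m + m') j = col_sum m j + col_sum m' j"
  by (simp_all add: row_sum_def col_sum_def lookup_add sum.distrib)

lemma row_sum_var [simp]: "row_sum (var_monom i j) k = (if k = i then 1 else 0)"
  and col_sum_var [simp]: "col_sum (var_monom i j) l = (if l = j then 1 else 0)"
  by (auto simp: row_sum_def col_sum_def)

lemma row_sum_sum: "row_sum (sum f S) i = (\<Sum>x\<in>S. row_sum (f x) i)"
  and col_sum_sum: "col_sum (sum f S) j = (\<Sum>x\<in>S. col_sum (f x) j)"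
  by (induction S rule: infinite_finite_induct) simp_all

lemma monom_degree_row: "monom_degree m = (\<Sum>i\<in>UNIV. row_sum m i)"
  and monom_degree_col: "monom_degree m = (\<Sum>j\<in>UNIV. col_sum m j)"
proof -
  show "monom_degree m = (\<Sum>i\<in>UNIV. row_sum m i)"
    by (simp add: monom_degree_def row_sum_def sum.cartesian_product UNIV_Times_UNIV)
  then show "monom_degree m = (\<Sum>j\<in>UNIV. col_sum m j)"
    unfolding row_sum_def col_sum_def by (subst sum.swap)
qed

lemma monom_degree_add [simp]: "monom_degree (m + m') = monom_degree m + monom_degree m'"
  by (simp add: monom_degree_def lookup_add sum.distrib)

lemma monom_degree_var [simp]: "monom_degree (var_monom i j) = 1"
  by (simp add: monom_degree_def)

lemma lookup_le_row_sum: "Poly_Mapping.lookup m (i, j) \<le> row_sum m i"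
  and lookup_le_col_sum: "Poly_Mapping.lookup m (i, j) \<le> col_sum m j"
  unfolding row_sum_def col_sum_def
  by (rule member_le_sum[of _ _ "\<lambda>j. Poly_Mapping.lookup m (i, j)"], auto)
     (rule member_le_sum[of _ _ "\<lambda>i. Poly_Mapping.lookup m (i, j)"], auto)

lemma monom_split:
  assumes "Poly_Mapping.lookup m (i, j) > 0"
  obtains m' where "m = var_monom i j + m'"
proof
  show "m = var_monom i j + (m - var_monom i j)"
    using assms by (intro poly_mapping_eqI) (auto simp: lookup_add lookup_minus)
qed

lemma row_sum_posE:
  assumes "row_sum m i > 0"
  obtains j where "Poly_Mapping.lookup m (i, j) > 0"
  using assms unfolding row_sum_def by (metis gr0I sum.neutral less_irrefl)

lemma col_sum_posE:
  assumes "col_sum m j > 0"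
  obtains i where "Poly_Mapping.lookup m (i, j) > 0"
  using assms unfolding col_sum_def by (metis gr0I sum.neutral less_irrefl)

section \<open>Acceptability through row and column sums\<close>

lemma acceptable_rowD:
  assumes "acceptable m" "Poly_Mapping.lookup m (i, j) > 0" "Poly_Mapping.lookup m (i, j') > 0"
  shows "j = j'"
proof -
  have "(i, j) \<in> Poly_Mapping.keys m" "(i, j') \<in> Poly_Mapping.keys m"
    using assms by (simp_all add: in_keys_iff)
  moreover have "\<forall>v\<in>Poly_Mapping.keys m. \<forall>w\<in>Poly_Mapping.keys m.
      v \<noteq> w \<longrightarrow> fst v \<noteq> fst w \<and> snd v \<noteq> snd w"
    using assms(1) unfolding acceptable_def by (rule conjunct2)
  ultimately show ?thesis by fastforce
qed

lemma acceptable_colD: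
  assumes "acceptable m" "Poly_Mapping.lookup m (i, j) > 0" "Poly_Mapping.lookup m (i', j) > 0"
  shows "i = i'"
proof -
  have "(i, j) \<in> Poly_Mapping.keys m" "(i', j) \<in> Poly_Mapping.keys m"
    using assms by (simp_all add: in_keys_iff)
  moreover have "\<forall>v\<in>Poly_Mapping.keys m. \<forall>w\<in>Poly_Mapping.keys m.
      v \<noteq> w \<longrightarrow> fst v \<noteq> fst w \<and> snd v \<noteq> snd w"
    using assms(1) unfolding acceptable_def by (rule conjunct2)
  ultimately show ?thesis by fastforce
qed

text \<open>A line sum of at least 2 comes from a repeated variable or from two variables in one
  line. Hence acceptability is constant on each class of monomials with equal line sums.\<close>

lemma acceptable_iff_line_sums:
  "acceptable m \<longleftrightarrow> (\<forall>i. row_sum m i \<le> 1) \<and> (\<forall>j. col_sum m j \<le> 1)"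
proof
  assume acc: "acceptable m"
  have "row_sum m i \<le> 1" for i
  proof (rule ccontr)
    assume gt: "\<not> row_sum m i \<le> 1"
    then obtain j where j: "Poly_Mapping.lookup m (i, j) > 0"
      by (metis row_sum_posE not_le less_trans zero_less_one)
    then obtain m' where m': "m = var_monom i j + m'"
      by (rule monom_split)
    with gt have "row_sum m' i > 0" by simp
    then obtain j' where j': "Poly_Mapping.lookup m' (i, j') > 0"
      by (rule row_sum_posE)
    show False
    proof (cases "j = j'")
      case True
      with m' j' have "Poly_Mapping.lookup m (i, j) \<ge> 2" by (simp add: lookup_add)
      moreover have "Poly_Mapping.lookup m (i, j) \<le> 1" using acc by (simp add: acceptable_def)
      ultimately show False by simp
    next
      case False
      from m' j' have "Poly_Mapping.lookup m (i, j') > 0" by (simp add: lookup_add)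
      with j False acc show False by (blast dest: acceptable_rowD)
    qed
  qed
  moreover have "col_sum m j \<le> 1" for j
  proof (rule ccontr)
    assume gt: "\<not> col_sum m j \<le> 1"
    then obtain i where i: "Poly_Mapping.lookup m (i, j) > 0"
      by (metis col_sum_posE not_le less_trans zero_less_one)
    then obtain m' where m': "m = var_monom i j + m'"
      by (rule monom_split)
    with gt have "col_sum m' j > 0" by simp
    then obtain i' where i': "Poly_Mapping.lookup m' (i', j) > 0"
      by (rule col_sum_posE)
    show False
    proof (cases "i = i'")
      case True
      with m' i' have "Poly_Mapping.lookup m (i, j) \<ge> 2" by (simp add: lookup_add)
      moreover have "Poly_Mapping.lookup m (i, j) \<le> 1" using acc by (simp add: acceptable_def)
      ultimately show False by simp
    next
      case False
      from m' i' have "Poly_Mapping.lookup m (i', j) > 0" by (simp add: lookup_add)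
      with i False acc show False by (blast dest: acceptable_colD)
    qed
  qed
  ultimately show "(\<forall>i. row_sum m i \<le> 1) \<and> (\<forall>j. col_sum m j \<le> 1)" by blast
next
  assume sums: "(\<forall>i. row_sum m i \<le> 1) \<and> (\<forall>j. col_sum m j \<le> 1)"
  have "Poly_Mapping.lookup m v \<le> 1" for v
    using sums lookup_le_row_sum[of m "fst v" "snd v"] by (auto intro: order_trans)
  moreover have "fst v \<noteq> fst w \<and> snd v \<noteq> snd w"
    if "v \<in> Poly_Mapping.keys m" "w \<in> Poly_Mapping.keys m" "v \<noteq> w" for v w
  proof -
    obtain m' where m': "m = var_monom (fst v) (snd v) + m'"
      using \<open>v \<in> Poly_Mapping.keys m\<close> by (metis in_keys_iff gr0I prod.collapse monom_split)
    \<comment> \<open>With \<open>v\<close> split off, \<open>w\<close> still occurs in the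
      cofactor; sharing a line with \<open>v\<close> would make the sum of that line at least
      2.\<close>
    have "Poly_Mapping.lookup m' (fst w, snd w) > 0"
      using that unfolding m' by (auto simp: in_keys_iff lookup_add split: if_splits)
    then have "row_sum m' (fst w) > 0" "col_sum m' (snd w) > 0"
      by (meson less_le_trans lookup_le_row_sum lookup_le_col_sum)+
    moreover have "row_sum m (fst w) \<le> 1" "col_sum m (snd w) \<le> 1" using sums by auto
    ultimately show ?thesis unfolding m' by (auto split: if_splits)
  qed
  ultimately show "acceptable m" unfolding acceptable_def by blast
qed

text \<open>Two variables taken from an overfull line already form an unacceptable monomial. This is
  why generators of degree 2 suffice for unacceptable monomials of every degree.\<close>

lemma unacceptable_quadratic_factor:
  assumes "\<not> acceptable m"
  obtains q m' where "m = q + m'" "\<not> acceptable q" "monom_degree q = 2"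
proof -
  consider i where "row_sum m i \<ge> 2" | j where "col_sum m j \<ge> 2"
    using assms unfolding acceptable_iff_line_sums by (metis not_less_eq_eq numeral_2_eq_2 One_nat_def)
  then show thesis
  proof cases
    case 1
    then obtain j where "Poly_Mapping.lookup m (i, j) > 0"
      by (metis row_sum_posE less_le_trans zero_less_numeral)
    then obtain m' where m': "m = var_monom i j + m'" by (rule monom_split)
    with 1 have "row_sum m' i > 0" by simp
    then obtain j' where "Poly_Mapping.lookup m' (i, j') > 0" by (rule row_sum_posE)
    then obtain m'' where m'': "m' = var_monom i j' + m''" by (rule monom_split)
    \<comment> \<open>\<open>j'\<close> may equal \<open>j\<close>, in which case the factor is the
      square of a variable; the row sum is 2 either way.\<close>
    have "\<not> row_sum (var_monom i j + var_monom i j') i \<le> 1" by simp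
    then have "\<not> acceptable (var_monom i j + var_monom i j')"
      unfolding acceptable_iff_line_sums by blast
    moreover have "m = (var_monom i j + var_monom i j') + m''"
      by (simp only: m' m'' add.assoc)
    ultimately show thesis using that by fastforce
  next
    case 2
    then obtain i where "Poly_Mapping.lookup m (i, j) > 0"
      by (metis col_sum_posE less_le_trans zero_less_numeral)
    then obtain m' where m': "m = var_monom i j + m'" by (rule monom_split)
    with 2 have "col_sum m' j > 0" by simp
    then obtain i' where "Poly_Mapping.lookup m' (i', j) > 0" by (rule col_sum_posE)
    then obtain m'' where m'': "m' = var_monom i' j + m''" by (rule monom_split)
    have "\<not> col_sum (var_monom i j + var_monom i' j) j \<le> 1" by simp
    then have "\<not> acceptable (var_monom i j + var_monom i' j)"
      unfolding acceptable_iff_line_sums by blast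
    moreover have "m = (var_monom i j + var_monom i' j) + m''"
      by (simp only: m' m'' add.assoc)
    ultimately show thesis using that by fastforce
  qed
qed

section \<open>Coefficients of contractions and the apolar ideal\<close>

lemma monom_poly_add:
  "(monom_poly (m + m') :: ('n, 'k::field) matpoly) = monom_poly m * monom_poly m'"
  by (simp add: monom_poly_def mult_single)

lemma poly_as_sum_of_monoms:
  fixes p :: "('n, 'k::field) matpoly"
  shows "p = (\<Sum>\<alpha>\<in>Poly_Mapping.keys p. smult (Poly_Mapping.lookup p \<alpha>) (monom_poly \<alpha>))"
  by (intro poly_mapping_eqI)
     (simp add: smult_def monom_poly_def mult_single lookup_sum lookup_single when_def in_keys_iff)

lemma lookup_smult: "Poly_Mapping.lookup (smult c p) m = c * Poly_Mapping.lookup p m"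
  for p :: "('n, 'k::field) matpoly"
  by (simp add: smult_def mult_map_scale_conv_mult[symmetric] Poly_Mapping.map.rep_eq when_def)

lemma ideal_span_smult:
  "p \<in> ideal_span G \<Longrightarrow> smult c p \<in> ideal_span G" for p :: "('n, 'k::field) matpoly"
  unfolding smult_def by (rule ideal.span_scale)

text \<open>Contraction is the transpose of multiplication: \<alpha> reaches the coefficient of
  \<gamma> only through the monomial \<open>\<gamma> + \<alpha>\<close> of \<open>F\<close>. Summing
  over any finite superset of the keys lets several polynomials share one index set.\<close>

lemma lookup_contract:
  fixes \<Phi> F :: "('n, 'k::field) matpoly"
  assumes "finite S" "Poly_Mapping.keys \<Phi> \<subseteq> S"
  shows "Poly_Mapping.lookup (\<Phi> \<circ>\<^sub>c F) \<gamma> =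
    (\<Sum>\<alpha>\<in>S. Poly_Mapping.lookup \<Phi> \<alpha> * Poly_Mapping.lookup F (\<gamma> + \<alpha>))"
proof -
  have monom: "Poly_Mapping.lookup (contract_monom \<alpha> \<beta> :: ('n, 'k) matpoly) \<gamma> =
      (if \<beta> = \<gamma> + \<alpha> then 1 else 0)" for \<alpha> \<beta> :: "'n monomial"
  proof -
    \<comment> \<open>Subtraction of exponents is truncated; the pointwise comparison is what makes
      \<open>\<beta> - \<alpha> = \<gamma>\<close> reversible.\<close>
    have "((\<forall>v. Poly_Mapping.lookup \<alpha> v \<le> Poly_Mapping.lookup \<beta> v) \<and> \<beta> - \<alpha> = \<gamma>) \<longleftrightarrow> \<beta> = \<gamma> + \<alpha>"
      by (auto simp: poly_mapping_eq_iff fun_eq_iff lookup_add lookup_minus) (metis le_add_diff_inverse2)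
    then show ?thesis
      by (auto simp: contract_monom_def monom_poly_def lookup_single when_def)
  qed
  have "Poly_Mapping.lookup (\<Phi> \<circ>\<^sub>c F) \<gamma> = (\<Sum>\<alpha>\<in>Poly_Mapping.keys \<Phi>.
      \<Sum>\<beta>\<in>Poly_Mapping.keys F. if \<beta> = \<gamma> + \<alpha>
        then Poly_Mapping.lookup \<Phi> \<alpha> * Poly_Mapping.lookup F (\<gamma> + \<alpha>) else 0)"
    unfolding contract_def lookup_sum lookup_smult monom by (intro sum.cong) auto
  also have "\<dots> = (\<Sum>\<alpha>\<in>Poly_Mapping.keys \<Phi>. Poly_Mapping.lookup \<Phi> \<alpha> * Poly_Mapping.lookup F (\<gamma> + \<alpha>))"
    by (intro sum.cong) (auto simp: in_keys_iff)
  also have "\<dots> = (\<Sum>\<alpha>\<in>S. Poly_Mapping.lookup \<Phi> \<alpha> * Poly_Mapping.lookup F (\<gamma> + \<alpha>))"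
    using assms by (intro sum.mono_neutral_left) (auto simp: in_keys_iff)
  finally show ?thesis .
qed

lemma contract_add: "(\<Phi> + \<Psi>) \<circ>\<^sub>c F = \<Phi> \<circ>\<^sub>c F + \<Psi> \<circ>\<^sub>c F"
  for \<Phi> \<Psi> F :: "('n, 'k::field) matpoly"
proof (intro poly_mapping_eqI)
  fix \<gamma>
  let ?S = "Poly_Mapping.keys \<Phi> \<union> Poly_Mapping.keys \<Psi>"
  have "Poly_Mapping.keys (\<Phi> + \<Psi>) \<subseteq> ?S" by (rule Poly_Mapping.keys_add)
  then show "Poly_Mapping.lookup ((\<Phi> + \<Psi>) \<circ>\<^sub>c F) \<gamma> = Poly_Mapping.lookup (\<Phi> \<circ>\<^sub>c F + \<Psi> \<circ>\<^sub>c F) \<gamma>"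
    by (simp add: lookup_contract[of ?S] lookup_add sum.distrib distrib_right)
qed

lemma contract_zero [simp]: "0 \<circ>\<^sub>c F = 0"
  by (simp add: contract_def)

text \<open>Contracting by a product is contracting twice, and contraction by a monomial shifts
  coefficients by its exponent.\<close>

lemma lookup_contract_monom_mult:
  fixes \<Phi> F :: "('n, 'k::field) matpoly"
  shows "Poly_Mapping.lookup ((Poly_Mapping.single m c * \<Phi>) \<circ>\<^sub>c F) \<gamma> =
    c * Poly_Mapping.lookup (\<Phi> \<circ>\<^sub>c F) (\<gamma> + m)"
proof -
  let ?K = "Poly_Mapping.keys \<Phi>"
  have eq: "Poly_Mapping.single m c * \<Phi> =
      (\<Sum>\<alpha>\<in>?K. Poly_Mapping.single (m + \<alpha>) (c * Poly_Mapping.lookup \<Phi> \<alpha>))"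
    by (subst (1) poly_as_sum_of_monoms)
       (simp add: sum_distrib_left smult_def monom_poly_def mult_single)
  have coeff: "Poly_Mapping.lookup (Poly_Mapping.single m c * \<Phi>) (m + \<alpha>) =
      c * Poly_Mapping.lookup \<Phi> \<alpha>" for \<alpha>
    by (simp add: eq lookup_sum lookup_single when_def in_keys_iff)
  \<comment> \<open>An inclusion only, since \<open>c\<close> may be 0; the superset form of
    \<open>lookup_contract\<close> allows for that.\<close>
  have "Poly_Mapping.keys (Poly_Mapping.single m c * \<Phi>) \<subseteq> (+) m ` ?K"
  proof
    fix \<beta> assume "\<beta> \<in> Poly_Mapping.keys (Poly_Mapping.single m c * \<Phi>)"
    then have "(\<Sum>\<alpha>\<in>?K. Poly_Mapping.lookup
        (Poly_Mapping.single (m + \<alpha>) (c * Poly_Mapping.lookup \<Phi> \<alpha>)) \<beta>) \<noteq> 0"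
      by (simp add: eq in_keys_iff lookup_sum)
    then obtain \<alpha> where "\<alpha> \<in> ?K" "Poly_Mapping.lookup
        (Poly_Mapping.single (m + \<alpha>) (c * Poly_Mapping.lookup \<Phi> \<alpha>)) \<beta> \<noteq> 0"
      by (meson sum.not_neutral_contains_not_neutral)
    then show "\<beta> \<in> (+) m ` ?K" by (auto simp: lookup_single when_def split: if_splits)
  qed
  then show ?thesis
    by (simp add: lookup_contract[of "(+) m ` ?K"] lookup_contract[of ?K] sum.reindex coeff
        sum_distrib_left add.assoc mult.assoc)
qed

text \<open>For closure under multiplication, a monomial multiple merely shifts the coefficients of
  a contraction that is already zero, and an arbitrary multiplier is a sum of such terms.\<close>

lemma subspace_apolar_ideal: "ideal.subspace (apolar_ideal F)"
  for F :: "('n, 'k::field) matpoly"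
proof (rule ideal.subspaceI)
  show "0 \<in> apolar_ideal F" by (simp add: apolar_ideal_def)
next
  fix \<Phi> \<Psi> assume "\<Phi> \<in> apolar_ideal F" "\<Psi> \<in> apolar_ideal F"
  then show "\<Phi> + \<Psi> \<in> apolar_ideal F" by (simp add: apolar_ideal_def contract_add)
next
  fix p \<Phi> assume \<Phi>: "\<Phi> \<in> apolar_ideal F"
  \<comment> \<open>The induction runs over a finite set \<open>S\<close> of exponents with
    \<open>p\<close> fixed; taking the keys of \<open>p\<close> for \<open>S\<close> recovers
    \<open>p\<close>.\<close>
  have "(\<Sum>\<alpha>\<in>S. smult (Poly_Mapping.lookup p \<alpha>) (monom_poly \<alpha>)) * \<Phi> \<in> apolar_ideal F"
    if "finite S" for S
    using that
  proof induction
    case empty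
    then show ?case by (simp add: apolar_ideal_def)
  next
    case (insert \<alpha> S)
    have "(Poly_Mapping.single \<alpha> (Poly_Mapping.lookup p \<alpha>) * \<Phi>) \<circ>\<^sub>c F = 0"
      using \<Phi> by (intro poly_mapping_eqI) (simp add: lookup_contract_monom_mult apolar_ideal_def)
    with insert show ?case
      by (simp add: apolar_ideal_def contract_add distrib_right smult_def monom_poly_def mult_single)
  qed
  from this[of "Poly_Mapping.keys p"] show "p * \<Phi> \<in> apolar_ideal F"
    by (simp flip: poly_as_sum_of_monoms)
qed

section \<open>Monomials of the permanent\<close>

lemma monom_poly_sum:
  "finite S \<Longrightarrow> (monom_poly (sum f S) :: ('n, 'k::field) matpoly) = (\<Prod>x\<in>S. monom_poly (f x))"
  by (induction S rule: finite_induct) (simp_all add: monom_poly_add, simp add: monom_poly_def)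

text \<open>Line sums of 1 force a single entry 1 in each row and column, so the exponents form a
  permutation matrix, from which the permutation can be read off.\<close>

lemma permutation_monomials:
  "bij_betw (\<lambda>\<sigma>. \<Sum>i\<in>UNIV. var_monom i (\<sigma> i)) {\<sigma>. \<sigma> permutes (UNIV :: 'n::finite set)}
    {m. (\<forall>i. row_sum m i = 1) \<and> (\<forall>j. col_sum m j = 1)}"
proof -
  let ?f = "\<lambda>\<sigma>::'n \<Rightarrow> 'n. \<Sum>i\<in>UNIV. var_monom i (\<sigma> i)"
  have lookup: "Poly_Mapping.lookup (?f \<sigma>) (i, j) = (if j = \<sigma> i then 1 else 0)" for \<sigma> i j
  proof -
    have "Poly_Mapping.lookup (?f \<sigma>) (i, j) = (\<Sum>k\<in>UNIV. if k = i then if j = \<sigma> i then 1 else 0 else 0)"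
      unfolding lookup_sum by (intro sum.cong) auto
    then show ?thesis by simp
  qed
  show ?thesis
  proof (rule bij_betw_imageI)
    show "inj_on ?f {\<sigma>. \<sigma> permutes UNIV}"
    proof (rule inj_onI)
      fix \<sigma> \<tau> assume "?f \<sigma> = ?f \<tau>"
      then have "Poly_Mapping.lookup (?f \<sigma>) (i, \<sigma> i) = Poly_Mapping.lookup (?f \<tau>) (i, \<sigma> i)" for i
        by simp
      then show "\<sigma> = \<tau>" unfolding lookup by (metis ext zero_neq_one)
    qed
    show "?f ` {\<sigma>. \<sigma> permutes UNIV} = {m. (\<forall>i. row_sum m i = 1) \<and> (\<forall>j. col_sum m j = 1)}"
    proof (intro equalityI subsetI)
      fix m assume "m \<in> ?f ` {\<sigma>. \<sigma> permutes UNIV}"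
      then obtain \<sigma> where \<sigma>: "\<sigma> permutes UNIV" and m: "m = ?f \<sigma>" by blast
      have "col_sum m j = 1" for j
      proof -
        have "(j = \<sigma> i) = (i = inv \<sigma> j)" for i using permutes_inv_eq[OF \<sigma>, of j i] by auto
        then show ?thesis unfolding m col_sum_def lookup by simp
      qed
      moreover have "row_sum m i = 1" for i unfolding m row_sum_def lookup by simp
      ultimately show "m \<in> {m. (\<forall>i. row_sum m i = 1) \<and> (\<forall>j. col_sum m j = 1)}" by simp
    next
      fix m assume "m \<in> {m::'n monomial. (\<forall>i. row_sum m i = 1) \<and> (\<forall>j. col_sum m j = 1)}"
      then have row: "row_sum m i = 1" and col: "col_sum m j = 1" for i j by auto
      then have acc: "acceptable m" by (simp add: acceptable_iff_line_sums)
      have "\<exists>j. Poly_Mapping.lookup m (i, j) > 0" for i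
        by (metis row row_sum_posE zero_less_one)
      then obtain \<sigma> where \<sigma>: "Poly_Mapping.lookup m (i, \<sigma> i) > 0" for i by metis
      have eq: "Poly_Mapping.lookup m (i, j) = (if j = \<sigma> i then 1 else 0)" for i j
      proof (cases "j = \<sigma> i")
        case True
        moreover have "Poly_Mapping.lookup m (i, \<sigma> i) \<le> 1" using acc by (simp add: acceptable_def)
        ultimately show ?thesis using \<sigma>[of i] by simp
      next
        case False
        then have "\<not> Poly_Mapping.lookup m (i, j) > 0"
          using acceptable_rowD[OF acc \<sigma>] by blast
        with False show ?thesis by simp
      qed
      \<comment> \<open>Every column sum is positive, so every column is the value of some row;
        finiteness then turns surjectivity into bijectivity.\<close>
      have "surj \<sigma>" unfolding surj_def
        by (metis col col_sum_posE eq less_irrefl zero_less_one)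
      then have "\<sigma> permutes UNIV"
        by (intro bij_imp_permutes) (simp_all add: bij_def finite_UNIV_surj_inj)
      moreover have "m = ?f \<sigma>"
        by (intro poly_mapping_eqI) (metis eq lookup surj_pair)
      ultimately show "m \<in> ?f ` {\<sigma>. \<sigma> permutes UNIV}" by blast
    qed
  qed
qed

text \<open>Distinct permutations yield distinct monomials, so no two terms merge and each
  coefficient that occurs is 1.\<close>

lemma lookup_permanent:
  "Poly_Mapping.lookup (permanent (generic_matrix :: ('n::finite, 'k::field) matpoly ^ 'n ^ 'n)) m =
    (if (\<forall>i. row_sum m i = 1) \<and> (\<forall>j. col_sum m j = 1) then 1 else 0)"
proof -
  let ?f = "\<lambda>\<sigma>::'n \<Rightarrow> 'n. \<Sum>i\<in>UNIV. var_monom i (\<sigma> i)"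
  let ?P = "{\<sigma>. \<sigma> permutes (UNIV :: 'n set)}"
  let ?M = "{m::'n monomial. (\<forall>i. row_sum m i = 1) \<and> (\<forall>j. col_sum m j = 1)}"
  have fin: "finite ?P" by (rule finite_permutations) simp
  have "permanent (generic_matrix :: ('n, 'k) matpoly ^ 'n ^ 'n) = (\<Sum>\<sigma>\<in>?P. monom_poly (?f \<sigma>))"
    by (simp add: permanent_def generic_matrix_def monom_poly_sum var_monom_def)
  also have "\<dots> = (\<Sum>m\<in>?M. monom_poly m)"
    by (rule sum.reindex_bij_betw[OF permutation_monomials])
  finally have eq: "permanent (generic_matrix :: ('n, 'k) matpoly ^ 'n ^ 'n) = (\<Sum>m\<in>?M. monom_poly m)" .
  have "finite ?M" using fin bij_betw_finite[OF permutation_monomials] by blast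
  then show ?thesis
    unfolding eq lookup_sum monom_poly_def lookup_single when_def by simp
qed

text \<open>The condition on \<alpha> involves only its line sums, so for fixed \<gamma> the sum
  runs over at most one class of monomials with equal line sums.\<close>

lemma lookup_contract_permanent:
  fixes \<Phi> :: "('n::finite, 'k::field) matpoly"
  shows "Poly_Mapping.lookup (\<Phi> \<circ>\<^sub>c permanent generic_matrix) \<gamma> =
    (\<Sum>\<alpha> | \<alpha> \<in> Poly_Mapping.keys \<Phi> \<and> (\<forall>i. row_sum \<gamma> i + row_sum \<alpha> i = 1) \<and>
      (\<forall>j. col_sum \<gamma> j + col_sum \<alpha> j = 1). Poly_Mapping.lookup \<Phi> \<alpha>)"
  unfolding lookup_contract[OF finite_keys subset_refl] lookup_permanent
  by (subst Collect_conj_eq, subst Collect_mem_eq)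
     (auto simp: sum.inter_restrict intro!: sum.cong)

lemma monom_poly_contract_permanent:
  "Poly_Mapping.lookup (monom_poly \<alpha> \<circ>\<^sub>c permanent (generic_matrix :: ('n::finite, 'k::field) matpoly ^ 'n ^ 'n)) \<gamma> =
    (if (\<forall>i. row_sum \<gamma> i + row_sum \<alpha> i = 1) \<and> (\<forall>j. col_sum \<gamma> j + col_sum \<alpha> j = 1) then 1 else 0)"
  by (subst lookup_contract[of "{\<alpha>}"])
     (simp_all add: monom_poly_def lookup_permanent)

section \<open>The generators annihilate the permanent\<close>

text \<open>A line sum above 1 cannot be brought down to 1 by multiplying with another monomial
  \<gamma>.\<close>

lemma unacceptable_in_apolar_ideal:
  assumes "\<not> acceptable m"
  shows "monom_poly m \<in> apolar_ideal (permanent (generic_matrix :: ('n::finite, 'k::field) matpoly ^ 'n ^ 'n))"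
proof -
  have "\<not> ((\<forall>i. row_sum \<gamma> i + row_sum m i = 1) \<and> (\<forall>j. col_sum \<gamma> j + col_sum m j = 1))" for \<gamma>
    using assms unfolding acceptable_iff_line_sums by (metis le_add2)
  then show ?thesis unfolding apolar_ideal_def
    by (simp add: poly_mapping_eq_iff fun_eq_iff monom_poly_contract_permanent del: de_Morgan_conj)
qed

text \<open>Contracting the permanent by a monomial depends only on the line sums of that monomial.
  The two terms of a minor use the same rows and the same columns, so this covers the
  minors.\<close>

lemma equal_line_sums_in_apolar_ideal:
  assumes "row_sum m = row_sum m'" "col_sum m = col_sum m'"
  shows "monom_poly m - monom_poly m' \<in>
    apolar_ideal (permanent (generic_matrix :: ('n::finite, 'k::field) matpoly ^ 'n ^ 'n))"
    (is "_ \<in> apolar_ideal ?F")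
proof -
  have "monom_poly m \<circ>\<^sub>c ?F = monom_poly m' \<circ>\<^sub>c ?F"
    by (intro poly_mapping_eqI) (simp add: monom_poly_contract_permanent assms)
  \<comment> \<open>Additivity, applied to the first monomial written as the difference plus the
    second, serves as the rule for differences.\<close>
  moreover have "monom_poly m \<circ>\<^sub>c ?F =
      (monom_poly m - monom_poly m') \<circ>\<^sub>c ?F + monom_poly m' \<circ>\<^sub>c ?F"
    by (simp flip: contract_add)
  ultimately show ?thesis by (simp add: apolar_ideal_def)
qed

lemma generic_minor:
  "generic_matrix $ i $ j * generic_matrix $ k $ l - generic_matrix $ i $ l * generic_matrix $ k $ j =
    (monom_poly (var_monom i j + var_monom k l) - monom_poly (var_monom i l + var_monom k j)
      :: ('n::finite, 'k::field) matpoly)"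
  by (simp add: generic_matrix_def monom_poly_add var_monom_def)

lemma line_sums_of_minor:
  "row_sum (var_monom i j + var_monom k l) = row_sum (var_monom i l + var_monom k j)"
  "col_sum (var_monom i j + var_monom k l) = col_sum (var_monom i l + var_monom k j)"
  by (auto simp: fun_eq_iff)

text \<open>Scalars act as constant polynomials. This lets \<open>linear.span_minimal\<close> reduce
  the containment of both generating spaces to their spanning elements.\<close>

lemma linear_subspace_if_ideal: "ideal.subspace I \<Longrightarrow> linear.subspace I"
  for I :: "('n, 'k::field) matpoly set"
  unfolding ideal.subspace_def linear.subspace_def smult_def by blast

lemma apolar_ideal_permanent_superset:
  "ideal_span (minor_space generic_matrix + unacceptable_space) \<subseteq>
    apolar_ideal (permanent (generic_matrix :: ('n::finite, 'k::field) matpoly ^ 'n ^ 'n))"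
    (is "_ \<subseteq> ?I")
proof (rule ideal.span_minimal[OF _ subspace_apolar_ideal])
  have sub: "linear.subspace ?I"
    by (rule linear_subspace_if_ideal[OF subspace_apolar_ideal])
  have "minor_space generic_matrix \<subseteq> ?I"
    unfolding minor_space_def generic_minor
    by (rule linear.span_minimal[OF _ sub])
       (auto intro!: equal_line_sums_in_apolar_ideal line_sums_of_minor simp del: row_sum_add col_sum_add)
  moreover have "unacceptable_space \<subseteq> ?I"
    unfolding unacceptable_space_def
    by (rule linear.span_minimal[OF _ sub]) (auto intro: unacceptable_in_apolar_ideal)
  ultimately show "minor_space generic_matrix + unacceptable_space \<subseteq> ?I"
    using ideal.subspace_add[OF subspace_apolar_ideal] by (fastforce elim!: set_plus_elim)
qed

section \<open>Congruence modulo the minors\<close>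

text \<open>By induction on the degree: a common variable is cancelled, and if the variable chosen
  from \<open>m\<close> is absent from \<open>m'\<close>, one minor brings it in. In other words,
  nonnegative integer matrices with the same margins are connected by basic 2 x 2 moves.\<close>

lemma equal_line_sums_congruent:
  fixes m m' :: "'n::finite monomial"
  assumes "row_sum m = row_sum m'" "col_sum m = col_sum m'"
  shows "(monom_poly m - monom_poly m' :: ('n, 'k::field) matpoly) \<in>
    ideal_span (minor_space generic_matrix)"
  using assms
proof (induction "monom_degree m" arbitrary: m m')
  case 0
  have "monom_degree m' = 0" using 0 by (simp add: monom_degree_row)
  with 0 have "m = m'"
    by (intro poly_mapping_eqI) (auto simp: monom_degree_def)
  then show ?case by (simp add: ideal.span_zero)
next
  case (Suc d)
  let ?J = "ideal_span (minor_space generic_matrix) :: ('n, 'k) matpoly set"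
  \<comment> \<open>When a variable is shared, the cofactors have equal line sums and degree
    \<open>d\<close>, so the induction hypothesis applies to them and the variable is multiplied
    back.\<close>
  have cancel: "monom_poly (var_monom i j + n) - monom_poly (var_monom i j + n') \<in> ?J"
    if "m = var_monom i j + n" "row_sum (var_monom i j + n) = row_sum (var_monom i j + n')"
      "col_sum (var_monom i j + n) = col_sum (var_monom i j + n')" for i j n n'
  proof -
    have "row_sum n = row_sum n'" "col_sum n = col_sum n'" "d = monom_degree n"
      using that Suc.hyps(2) by (auto simp: fun_eq_iff)
    then have "monom_poly n - monom_poly n' \<in> ?J" by (intro Suc.hyps(1)) auto
    then show ?thesis
      unfolding monom_poly_add right_diff_distrib[symmetric] by (rule ideal.span_scale)
  qed
  obtain i where "row_sum m i > 0"
    using Suc.hyps(2) by (metis monom_degree_row sum.neutral gr0I nat.distinct(1))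
  then obtain j where "Poly_Mapping.lookup m (i, j) > 0" by (rule row_sum_posE)
  then obtain n where n: "m = var_monom i j + n" by (rule monom_split)
  have "row_sum m' i > 0" "col_sum m' j > 0"
    using Suc.prems[symmetric] by (simp_all add: n)
  show ?case
  proof (cases "Poly_Mapping.lookup m' (i, j) > 0")
    case True
    then obtain n' where "m' = var_monom i j + n'" by (rule monom_split)
    with cancel[OF n] Suc.prems show ?thesis by (simp only: n)
  next
    case False
    obtain l where l: "Poly_Mapping.lookup m' (i, l) > 0"
      using \<open>row_sum m' i > 0\<close> by (rule row_sum_posE)
    obtain k where k: "Poly_Mapping.lookup m' (k, j) > 0"
      using \<open>col_sum m' j > 0\<close> by (rule col_sum_posE)
    \<comment> \<open>Row \<open>i\<close> and column \<open>j\<close> are occupied in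
      \<open>m'\<close> but not at their crossing, so \<open>(i, l)\<close> and
      \<open>(k, j)\<close> are opposite corners of a genuine minor.\<close>
    from False k l have neq: "i \<noteq> k" "j \<noteq> l" by metis+
    obtain n' where n': "m' = var_monom i l + n'" using l by (rule monom_split)
    then have "Poly_Mapping.lookup n' (k, j) > 0"
      using k neq by (simp add: lookup_add)
    then obtain n'' where n'': "n' = var_monom k j + n''" by (rule monom_split)
    have m': "m' = (var_monom i l + var_monom k j) + n''" by (simp only: n' n'' add.assoc)
    \<comment> \<open>One minor moves the second monomial to \<open>?e\<close>, which shares a variable with \<open>m\<close>.\<close>
    let ?e = "var_monom i j + (var_monom k l + n'')"
    have e: "?e = (var_monom i j + var_monom k l) + n''" by (simp only: add.assoc)
    have "row_sum ?e = row_sum m'" "col_sum ?e = col_sum m'"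
      by (auto simp: m' fun_eq_iff)
    with Suc.prems have "monom_poly m - monom_poly ?e \<in> ?J"
      using cancel[OF n] by (simp only: n)
    moreover have "monom_poly ?e - monom_poly m' \<in> ?J"
    proof -
      have "monom_poly (var_monom i j + var_monom k l) - monom_poly (var_monom i l + var_monom k j)
          \<in> (minor_space generic_matrix :: ('n, 'k) matpoly set)"
        unfolding minor_space_def generic_minor using neq by (intro linear.span_base) blast
      then have "(monom_poly (var_monom i j + var_monom k l) - monom_poly (var_monom i l + var_monom k j))
          * monom_poly n'' \<in> ?J"
        by (subst mult.commute) (intro ideal.span_scale ideal.span_base)
      then show ?thesis
        by (simp only: e m' monom_poly_add[of _ n''] left_diff_distrib)
    qed
    ultimately have "(monom_poly m - monom_poly ?e) + (monom_poly ?e - monom_poly m') \<in> ?J"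
      by (rule ideal.span_add)
    then show ?thesis by simp
  qed
qed

section \<open>The apolar ideal lies in the generated ideal\<close>

text \<open>The elementwise sum of the two spaces contains each of them because the other one
  contains 0.\<close>

lemma ideal_span_minor_unacceptable:
  "ideal_span (minor_space D) \<subseteq> ideal_span (minor_space D + unacceptable_space)"
  "unacceptable_space \<subseteq> ideal_span (minor_space D + unacceptable_space)"
proof -
  have "minor_space D \<subseteq> minor_space D + unacceptable_space"
    using set_plus_intro[where b = 0 and D = unacceptable_space]
    by (force simp: unacceptable_space_def linear.span_zero)
  then show "ideal_span (minor_space D) \<subseteq> ideal_span (minor_space D + unacceptable_space)"
    by (rule ideal.span_mono)
  have "unacceptable_space \<subseteq> minor_space D + unacceptable_space"
    using set_plus_intro[where a = 0 and C = "minor_space D"]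
    by (force simp: minor_space_def linear.span_zero)
  then show "unacceptable_space \<subseteq> ideal_span (minor_space D + unacceptable_space)"
    using ideal.span_superset by blast
qed

lemma unacceptable_in_ideal:
  assumes "\<not> acceptable m"
  shows "(monom_poly m :: ('n::finite, 'k::field) matpoly) \<in> ideal_span (minor_space D + unacceptable_space)"
proof -
  obtain q m' where m: "m = m' + q" and q: "\<not> acceptable q" "monom_degree q = 2"
    using unacceptable_quadratic_factor[OF assms] by (metis add.commute)
  have "(monom_poly q :: ('n, 'k) matpoly) \<in> unacceptable_space"
    unfolding unacceptable_space_def using q by (intro linear.span_base) blast
  then show ?thesis
    unfolding m monom_poly_add using ideal_span_minor_unacceptable(2)[of D]
    by (intro ideal.span_scale) blast
qed

text \<open>An acceptable monomial of degree d uses d rows and d columns, so equally many rows and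
  columns remain free; \<gamma> matches them along a bijection.\<close>

lemma acceptable_complement:
  fixes m :: "'n::finite monomial"
  assumes "acceptable m"
  obtains \<gamma> where "\<And>i. row_sum \<gamma> i + row_sum m i = 1" "\<And>j. col_sum \<gamma> j + col_sum m j = 1"
proof -
  define I J where "I = {i. row_sum m i = 0}" and "J = {j. col_sum m j = 0}"
  have row: "row_sum m i = (if i \<in> - I then 1 else 0)" for i
    using assms by (simp add: acceptable_iff_line_sums I_def le_antisym Suc_leI)
  have col: "col_sum m j = (if j \<in> - J then 1 else 0)" for j
    using assms by (simp add: acceptable_iff_line_sums J_def le_antisym Suc_leI)
  have "card (- I) = monom_degree m"
    unfolding monom_degree_row row by (simp only: sum.inter_restrict[symmetric] finite) simp
  moreover have "card (- J) = monom_degree m"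
    unfolding monom_degree_col col by (simp only: sum.inter_restrict[symmetric] finite) simp
  ultimately have "card (UNIV - - I) = card (UNIV - - J)"
    by (simp only: card_Diff_subset finite subset_UNIV)
  then have "card I = card J" by (simp add: Compl_eq_Diff_UNIV[symmetric])
  then obtain f where f: "bij_betw f I J"
    using finite_same_card_bij[of I J] by auto
  let ?g = "\<Sum>i\<in>I. var_monom i (f i)"
  have "col_sum ?g j = (\<Sum>j'\<in>J. if j = j' then 1 else 0)" for j
    unfolding col_sum_sum using sum.reindex_bij_betw[OF f, of "\<lambda>j'. if j = j' then 1 else 0 :: nat"]
    by simp
  moreover have "row_sum ?g i = (\<Sum>i'\<in>I. if i = i' then 1 else 0)" for i
    unfolding row_sum_sum by simp
  ultimately show thesis by (intro that[of ?g]) (simp_all add: row col)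
qed

lemma apolar_ideal_permanent_subset:
  "apolar_ideal (permanent (generic_matrix :: ('n::finite, 'k::field) matpoly ^ 'n ^ 'n)) \<subseteq>
    ideal_span (minor_space generic_matrix + unacceptable_space)"
    (is "_ \<subseteq> ?J")
proof
  fix \<Phi> :: "('n, 'k) matpoly"
  assume \<Phi>: "\<Phi> \<in> apolar_ideal (permanent generic_matrix)"
  let ?K = "Poly_Mapping.keys \<Phi>"
  let ?c = "Poly_Mapping.lookup \<Phi>"
  let ?t = "\<lambda>m. (row_sum m, col_sum m)"
  \<comment> \<open>One class at a time: \<open>?t\<close> records the line sums, and
    \<open>?s\<close> collects the terms of \<Phi> with the common value \<open>t\<close>.\<close>
  have "(\<Sum>\<alpha> | \<alpha> \<in> ?K \<and> ?t \<alpha> = t. smult (?c \<alpha>) (monom_poly \<alpha>)) \<in> ?J" (is "?s \<in> _")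
    if t: "t \<in> ?t ` ?K" for t
  proof -
    obtain \<beta> where \<beta>: "t = ?t \<beta>" using t by blast
    show ?thesis
    proof (cases "acceptable \<beta>")
      case False
      then have "\<not> acceptable \<alpha>" if "?t \<alpha> = t" for \<alpha>
        using that \<beta> by (simp add: acceptable_iff_line_sums)
      then show ?thesis
        by (intro ideal.span_sum ideal_span_smult unacceptable_in_ideal) blast
    next
      case True
      then obtain \<gamma> where \<gamma>: "\<And>i. row_sum \<gamma> i + row_sum \<beta> i = 1" "\<And>j. col_sum \<gamma> j + col_sum \<beta> j = 1"
        by (rule acceptable_complement) blast
      \<comment> \<open>Cancelling \<gamma> shows that the monomials completed by it are exactly
        those with the line sums of \<beta>.\<close>
      have "((\<forall>i. row_sum \<gamma> i + row_sum \<alpha> i = 1) \<and> (\<forall>j. col_sum \<gamma> j + col_sum \<alpha> j = 1))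
          \<longleftrightarrow> ?t \<alpha> = t" for \<alpha>
        unfolding \<beta> prod.inject fun_eq_iff by (metis \<gamma> add_left_cancel)
      then have zero: "(\<Sum>\<alpha> | \<alpha> \<in> ?K \<and> ?t \<alpha> = t. ?c \<alpha>) = 0"
        using \<Phi> lookup_contract_permanent[of \<Phi> \<gamma>] by (simp add: apolar_ideal_def)
      \<comment> \<open>Replacing each monomial of the class by the representative \<beta> costs
        only elements of the minor ideal; what remains is \<beta> times the coefficient sum, which
        is zero.\<close>
      have "?s = (\<Sum>\<alpha> | \<alpha> \<in> ?K \<and> ?t \<alpha> = t. smult (?c \<alpha>) (monom_poly \<alpha> - monom_poly \<beta>))
          + smult (\<Sum>\<alpha> | \<alpha> \<in> ?K \<and> ?t \<alpha> = t. ?c \<alpha>) (monom_poly \<beta>)"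
        by (simp add: linear.scale_right_diff_distrib sum_subtractf linear.scale_sum_left)
      also have "\<dots> = (\<Sum>\<alpha> | \<alpha> \<in> ?K \<and> ?t \<alpha> = t. smult (?c \<alpha>) (monom_poly \<alpha> - monom_poly \<beta>))"
        by (simp add: zero)
      also have "\<dots> \<in> ?J"
        using equal_line_sums_congruent ideal_span_minor_unacceptable(1) \<beta>
        by (intro ideal.span_sum ideal_span_smult) blast
      finally show ?thesis .
    qed
  qed
  \<comment> \<open>The classes partition the keys, so the class sums add up to \<Phi>.\<close>
  then have "(\<Sum>t\<in>?t ` ?K. \<Sum>\<alpha> | \<alpha> \<in> ?K \<and> ?t \<alpha> = t. smult (?c \<alpha>) (monom_poly \<alpha>)) \<in> ?J"
    by (rule ideal.span_sum)
  then show "\<Phi> \<in> ?J"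
    by (simp only: sum.image_gen[OF finite_keys, symmetric] poly_as_sum_of_monoms[symmetric])
qed

section \<open>Degree of the generators and conclusion\<close>

lemma subspace_homogeneous_part:
  "linear.subspace (homogeneous_part d :: ('n::finite, 'k::field) matpoly set)"
proof (rule linear.subspaceI)
  show "0 \<in> homogeneous_part d" by (simp add: homogeneous_part_def)
next
  fix p q :: "('n, 'k) matpoly" assume "p \<in> homogeneous_part d" "q \<in> homogeneous_part d"
  then show "p + q \<in> homogeneous_part d"
    unfolding homogeneous_part_def using Poly_Mapping.keys_add[of p q] by blast
next
  fix c and p :: "('n, 'k) matpoly" assume "p \<in> homogeneous_part d"
  then show "smult c p \<in> homogeneous_part d"
    by (auto simp: homogeneous_part_def in_keys_iff lookup_smult)
qed

lemma monom_poly_homogeneous: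
  "monom_degree m = d \<Longrightarrow> (monom_poly m :: ('n::finite, 'k::field) matpoly) \<in> homogeneous_part d"
  by (simp add: homogeneous_part_def monom_poly_def)

lemma generators_quadratic:
  "minor_space generic_matrix + unacceptable_space \<subseteq>
    (homogeneous_part 2 :: ('n::finite, 'k::field) matpoly set)"
proof -
  have "minor_space generic_matrix \<subseteq> (homogeneous_part 2 :: ('n, 'k) matpoly set)"
    unfolding minor_space_def generic_minor
    by (rule linear.span_minimal[OF _ subspace_homogeneous_part])
       (auto intro!: linear.subspace_diff[OF subspace_homogeneous_part] monom_poly_homogeneous)
  moreover have "unacceptable_space \<subseteq> (homogeneous_part 2 :: ('n, 'k) matpoly set)"
    unfolding unacceptable_space_def
    by (rule linear.span_minimal[OF _ subspace_homogeneous_part]) (auto intro: monom_poly_homogeneous)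
  ultimately show ?thesis
    using linear.subspace_add[OF subspace_homogeneous_part] by (fastforce elim!: set_plus_elim)
qed

theorem theorem2p13:
  fixes A D :: "('n::finite, 'k::field) matpoly ^ 'n ^ 'n"
  assumes char: "CHAR('k) = 0 \<or> CHAR('k) > 2"
    and A: "A = generic_matrix"
    and D: "D = generic_matrix"
  shows "apolar_ideal (permanent A) = ideal_span (minor_space D + unacceptable_space)
    \<and> generated_in_degree 2 (apolar_ideal (permanent A))"
proof -
  have "apolar_ideal (permanent A) = ideal_span (minor_space D + unacceptable_space)"
    unfolding A D
    by (rule equalityI[OF apolar_ideal_permanent_subset apolar_ideal_permanent_superset])
  \<comment> \<open>The set \<open>minor_space D + unacceptable_space\<close> itself, being
    quadratic, witnesses generation in degree two.\<close>
  then show ?thesis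
    unfolding generated_in_degree_def D using generators_quadratic by blast
qed

end
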